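(* Let $A,B,C$ be a Leonard triple on $V$ that has $q$-Racah type with Huang data $(a,b,c,d)$, and let $W,W',W''\in\mathrm{End}(V)$ be as defined in the context. Then each of the elements $W'W$, $W''W'$, $WW''$ commutes with $A+B+C$.
   Context: Let $\mathbb F$ be a field, $d\ge 0$ an integer, $V$ a vector space over $\mathbb F$ of dimension $d+1$, $\mathrm{End}(V)$ the $\mathbb F$-algebra of $\mathbb F$-linear maps $V\to V$, and $I$ its identity. A square matrix is tridiagonal if each nonzero entry lies on the diagonal, subdiagonal or superdiagonal; a tridiagonal matrix is irreducible if every subdiagonal entry and every superdiagonal entry is nonzero. Leonard triple on $V$: a 3-tuple $A,B,C$ of elements of $\mathrm{End}(V)$ such that (i) there is a basis of $V$ with respect to which $A$ is represented by a diagonal matrix and $B,C$ by irreducible tridiagonal matrices; (ii) there is a basis with respect to which $B$ is diagonal and $C,A$ are irreducible tridiagonal; (iii) there is a basis with respect to which $C$ is diagonal and $A,B$ are irreducible tridiagonal. Each of $A,B,C$ is then diagonalizable with one-dimensional eigenspaces. An ordering of the eigenvalues of $A$ is standard if corresponding eigenvectors, in that order, form a basis as in (i); similarly for $B$ with (ii) and $C$ with (iii). Standing assumptions: fix a nonzero $q\in\mathbb F$ with $q^4\ne 1$ and nonzero $a,b,c\in\mathbb F$ such that $q^{2i}\ne 1$ for $1\le i\le d$; none of $a^2,b^2,c^2$ is among $q^{2d-2},q^{2d-4},\ldots,q^{2-2d}$; none of $abc,a^{-1}bc,ab^{-1}c,abc^{-1}$ is among $q^{d-1},q^{d-3},\ldots,q^{1-d}$.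 For $0\le i\le d$ let $\theta_i=aq^{2i-d}+a^{-1}q^{d-2i}$, $\theta'_i=bq^{2i-d}+b^{-1}q^{d-2i}$, $\theta''_i=cq^{2i-d}+c^{-1}q^{d-2i}$. A Leonard triple $A,B,C$ on $V$ has $q$-Racah type with Huang data $(a,b,c,d)$ if $\{\theta_i\}_{i=0}^d$, $\{\theta'_i\}_{i=0}^d$, $\{\theta''_i\}_{i=0}^d$ are standard orderings of the eigenvalues of $A$, $B$, $C$ respectively, and $$A+\frac{qBC-q^{-1}CB}{q^2-q^{-2}}=\alpha_a I,\quad B+\frac{qCA-q^{-1}AC}{q^2-q^{-2}}=\alpha_b I,\quad C+\frac{qAB-q^{-1}BA}{q^2-q^{-2}}=\alpha_c I,$$ where $\alpha_a=\frac{(a+a^{-1})(q^{d+1}+q^{-d-1})+(b+b^{-1})(c+c^{-1})}{q+q^{-1}}$, $\alpha_b=\frac{(b+b^{-1})(q^{d+1}+q^{-d-1})+(c+c^{-1})(a+a^{-1})}{q+q^{-1}}$, $\alpha_c=\frac{(c+c^{-1})(q^{d+1}+q^{-d-1})+(a+a^{-1})(b+b^{-1})}{q+q^{-1}}$. For $0\le i\le d$ let $E_i$ (resp. $E'_i$, $E''_i$) be the primitive idempotent of $A$ (resp. $B$, $C$) for $\theta_i$ (resp. $\theta'_i$, $\theta''_i$): the projection of $V$ onto that eigenspace that is zero on the other eigenspaces. Define $$W=\sum_{i=0}^d(-1)^ia^{-i}q^{i(d-i)}E_i,\quad W'=\sum_{i=0}^d(-1)^ib^{-i}q^{i(d-i)}E'_i,\quad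 W''=\sum_{i=0}^d(-1)^ic^{-i}q^{i(d-i)}E''_i.$$ *)

theory Defs
  imports Complex_Main
begin

text \<open>Matrices are functions of a row and a column index, both ranging over \<open>{..d}\<close>;
  entries outside that range are irrelevant.\<close>

definition diagonal_matrix :: "nat \<Rightarrow> (nat \<Rightarrow> nat \<Rightarrow> 'a::zero) \<Rightarrow> bool" where
  "diagonal_matrix d M \<longleftrightarrow> (\<forall>i\<le>d. \<forall>j\<le>d. i \<noteq> j \<longrightarrow> M i j = 0)"

definition tridiagonal_matrix :: "nat \<Rightarrow> (nat \<Rightarrow> nat \<Rightarrow> 'a::zero) \<Rightarrow> bool" where
  "tridiagonal_matrix d M \<longleftrightarrow>
     (\<forall>i\<le>d. \<forall>j\<le>d. M i j \<noteq> 0 \<longrightarrow> i = j \<or> i = Suc j \<or> j = Suc i)"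

definition irreducible_tridiagonal_matrix ::
    "nat \<Rightarrow> (nat \<Rightarrow> nat \<Rightarrow> 'a::zero) \<Rightarrow> bool" where
  "irreducible_tridiagonal_matrix d M \<longleftrightarrow>
     tridiagonal_matrix d M \<and> (\<forall>i<d. M (Suc i) i \<noteq> 0 \<and> M i (Suc i) \<noteq> 0)"

definition huang_parameters ::
    "'a::field \<Rightarrow> 'a \<Rightarrow> 'a \<Rightarrow> 'a \<Rightarrow> nat \<Rightarrow> bool" where
  "huang_parameters q a b c d \<longleftrightarrow>
     q \<noteq> 0 \<and> q ^ 4 \<noteq> 1 \<and> a \<noteq> 0 \<and> b \<noteq> 0 \<and> c \<noteq> 0 \<and>
     (\<forall>i\<in>{1..d}. q ^ (2 * i) \<noteq> 1) \<and>
     (\<forall>x\<in>{a, b, c}. \<forall>j\<in>{1 - int d..int d - 1}. x ^ 2 \<noteq> q powi (2 * j)) \<and>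
     (\<forall>x\<in>{a * b * c, inverse a * b * c, a * inverse b * c, a * b * inverse c}.
        \<forall>k<d. x \<noteq> q powi (int d - 1 - 2 * int k))"

definition huang_theta :: "'a::field \<Rightarrow> nat \<Rightarrow> 'a \<Rightarrow> nat \<Rightarrow> 'a" where
  "huang_theta q d a i =
     a * q powi (2 * int i - int d) + inverse a * q powi (int d - 2 * int i)"

text \<open>The scalars \<open>\<alpha>\<^sub>a\<close>, \<open>\<alpha>\<^sub>b\<close>, \<open>\<alpha>\<^sub>c\<close> are obtained by cyclically permuting the last three
  arguments.\<close>

definition huang_alpha :: "'a::field \<Rightarrow> nat \<Rightarrow> 'a \<Rightarrow> 'a \<Rightarrow> 'a \<Rightarrow> 'a" where
  "huang_alpha q d a b c =
     ((a + inverse a) * (q powi (int d + 1) + q powi (- int d - 1))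
        + (b + inverse b) * (c + inverse c)) / (q + inverse q)"

locale vector_space_of_dim = vector_space scale
  for scale :: "'a::field \<Rightarrow> 'b::ab_group_add \<Rightarrow> 'b" (infixr "*s" 75) +
  fixes d :: nat
  assumes dim_UNIV: "dim UNIV = d + 1"
begin

definition ordered_basis :: "(nat \<Rightarrow> 'b) \<Rightarrow> bool" where
  "ordered_basis v \<longleftrightarrow>
     inj_on v {..d} \<and> independent (v ` {..d}) \<and> span (v ` {..d}) = UNIV"

definition represented_by ::
    "(nat \<Rightarrow> 'b) \<Rightarrow> ('b \<Rightarrow> 'b) \<Rightarrow> (nat \<Rightarrow> nat \<Rightarrow> 'a) \<Rightarrow> bool" where
  "represented_by v A M \<longleftrightarrow> (\<forall>j\<le>d. A (v j) = (\<Sum>i\<le>d. M i j *s v i))"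

definition leonard_basis ::
    "('b \<Rightarrow> 'b) \<Rightarrow> ('b \<Rightarrow> 'b) \<Rightarrow> ('b \<Rightarrow> 'b) \<Rightarrow> (nat \<Rightarrow> 'b) \<Rightarrow> bool" where
  "leonard_basis A B C v \<longleftrightarrow>
     ordered_basis v \<and>
     (\<exists>M. represented_by v A M \<and> diagonal_matrix d M) \<and>
     (\<exists>M. represented_by v B M \<and> irreducible_tridiagonal_matrix d M) \<and>
     (\<exists>M. represented_by v C M \<and> irreducible_tridiagonal_matrix d M)"

definition leonard_triple ::
    "('b \<Rightarrow> 'b) \<Rightarrow> ('b \<Rightarrow> 'b) \<Rightarrow> ('b \<Rightarrow> 'b) \<Rightarrow> bool" where
  "leonard_triple A B C \<longleftrightarrow>
     Vector_Spaces.linear (*s) (*s) A \<and>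
     Vector_Spaces.linear (*s) (*s) B \<and>
     Vector_Spaces.linear (*s) (*s) C \<and>
     (\<exists>v. leonard_basis A B C v) \<and>
     (\<exists>v. leonard_basis B C A v) \<and>
     (\<exists>v. leonard_basis C A B v)"

definition eigenspace :: "('b \<Rightarrow> 'b) \<Rightarrow> 'a \<Rightarrow> 'b set" where
  "eigenspace A t = {v. A v = t *s v}"

definition eigenvalues :: "('b \<Rightarrow> 'b) \<Rightarrow> 'a set" where
  "eigenvalues A = {t. \<exists>v\<in>eigenspace A t. v \<noteq> 0}"

text \<open>Standard orderings of the eigenvalues of the first map; those of the other two are obtained
  by cyclically permuting the maps. Since the eigenspaces are one-dimensional, it does not matter
  which eigenvectors are chosen.\<close>

definition standard_ordering ::
    "('b \<Rightarrow> 'b) \<Rightarrow> ('b \<Rightarrow> 'b) \<Rightarrow> ('b \<Rightarrow> 'b) \<Rightarrow> (nat \<Rightarrow> 'a) \<Rightarrow> bool" where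
  "standard_ordering A B C \<theta> \<longleftrightarrow>
     bij_betw \<theta> {..d} (eigenvalues A) \<and>
     (\<exists>v. (\<forall>i\<le>d. v i \<noteq> 0 \<and> v i \<in> eigenspace A (\<theta> i)) \<and> leonard_basis A B C v)"

definition q_racah_relation ::
    "'a \<Rightarrow> 'a \<Rightarrow> ('b \<Rightarrow> 'b) \<Rightarrow> ('b \<Rightarrow> 'b) \<Rightarrow> ('b \<Rightarrow> 'b) \<Rightarrow> bool" where
  "q_racah_relation q \<alpha> A B C \<longleftrightarrow>
     (\<forall>v. A v + inverse (q ^ 2 - q powi (-2)) *s (q *s B (C v) - inverse q *s C (B v)) = \<alpha> *s v)"

definition q_racah_leonard_triple ::
    "'a \<Rightarrow> 'a \<Rightarrow> 'a \<Rightarrow> 'a \<Rightarrow> ('b \<Rightarrow> 'b) \<Rightarrow> ('b \<Rightarrow> 'b) \<Rightarrow> ('b \<Rightarrow> 'b) \<Rightarrow> bool" where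
  "q_racah_leonard_triple q a b c A B C \<longleftrightarrow>
     leonard_triple A B C \<and>
     standard_ordering A B C (huang_theta q d a) \<and>
     standard_ordering B C A (huang_theta q d b) \<and>
     standard_ordering C A B (huang_theta q d c) \<and>
     q_racah_relation q (huang_alpha q d a b c) A B C \<and>
     q_racah_relation q (huang_alpha q d b c a) B C A \<and>
     q_racah_relation q (huang_alpha q d c a b) C A B"

text \<open>The description below determines the projection only for diagonalizable \<open>A\<close>, which is the
  case for each member of a Leonard triple.\<close>

definition primitive_idempotent :: "('b \<Rightarrow> 'b) \<Rightarrow> 'a \<Rightarrow> 'b \<Rightarrow> 'b" where
  "primitive_idempotent A t =
     (THE E. Vector_Spaces.linear (*s) (*s) E \<and>
        range E = eigenspace A t \<and>
        (\<forall>v\<in>eigenspace A t. E v = v) \<and>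
        (\<forall>s\<in>eigenvalues A - {t}. \<forall>v\<in>eigenspace A s. E v = 0))"

definition huang_W :: "'a \<Rightarrow> 'a \<Rightarrow> ('b \<Rightarrow> 'b) \<Rightarrow> 'b \<Rightarrow> 'b" where
  "huang_W q a A v =
     (\<Sum>i\<le>d. ((-1) ^ i * a powi (- int i) * q ^ (i * (d - i)))
        *s primitive_idempotent A (huang_theta q d a i) v)"

end

end

theory Submission
  imports Defs
begin

text \<open>
  Fix two members \<open>X\<close>, \<open>Y\<close> of the triple such that the third one is
  \<open>Z = \<alpha> - (q X Y - q\<^sup>-\<^sup>1 Y X) / (q\<^sup>2 - q\<^sup>-\<^sup>2)\<close>, and let
  \<open>Z\<^sub>o = \<alpha> - (q Y X - q\<^sup>-\<^sup>1 X Y) / (q\<^sup>2 - q\<^sup>-\<^sup>2)\<close> be its mirror image, in which \<open>X\<close> and \<open>Y\<close>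
  have traded places. The whole theorem rests on the single identity
  \<open>W\<^sub>X (X + Y + Z) = (X + Y + Z\<^sub>o) W\<^sub>X\<close> (lemma \<open>huang_W_intertwines\<close>).
  Exchanging \<open>X\<close> and \<open>Y\<close> exchanges \<open>Z\<close> and \<open>Z\<^sub>o\<close>, so the same identity also reads
  \<open>W\<^sub>Y (X + Y + Z\<^sub>o) = (X + Y + Z) W\<^sub>Y\<close>, and composing the two shows that \<open>W\<^sub>Y W\<^sub>X\<close> commutes with
  \<open>X + Y + Z\<close>. The three assertions are the cases \<open>(X, Y) = (A, B), (B, C), (C, A)\<close>.

  For the identity, pass to an eigenbasis of \<open>X\<close>. There \<open>W\<^sub>X\<close> is diagonal with entries \<open>t\<^sub>i\<close>, and the
  entries of \<open>Z\<close> and \<open>Z\<^sub>o\<close> off the diagonal are multiples of those of \<open>Y\<close>. The matrices of \<open>Z\<close> and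
  \<open>Z\<^sub>o\<close> have the same diagonal. Next to the diagonal the factors are exactly \<open>t\<^sub>j / t\<^sub>i\<close> for \<open>Z\<close> and
  \<open>t\<^sub>i / t\<^sub>j\<close> for \<open>Z\<^sub>o\<close> (lemma \<open>huang_theta_weight_Suc\<close>), so both sides have the entry
  \<open>(t\<^sub>i + t\<^sub>j) Y\<^sub>i\<^sub>j\<close>; since \<open>Y\<close> is tridiagonal there are no further entries.
\<close>

section \<open>The scalar identity\<close>

definition huang_weight :: "'a::field \<Rightarrow> nat \<Rightarrow> 'a \<Rightarrow> nat \<Rightarrow> 'a" where
  "huang_weight q d a i = (-1) ^ i * a powi (- int i) * q ^ (i * (d - i))"

lemma huang_weight_Suc:
  fixes q a :: "'a::field"
  assumes q: "q \<noteq> 0" and a: "a \<noteq> 0" and i: "i < d"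
  shows "huang_weight q d a (Suc i) =
    - inverse a * q powi (int d - 2 * int i - 1) * huang_weight q d a i"
proof -
  obtain k where "d = Suc (i + k)"
    using i less_imp_Suc_add by blast
  hence "int (Suc i * (d - Suc i)) = (int d - 2 * int i - 1) + int (i * (d - i))"
    by (simp add: algebra_simps)
  hence "q ^ (Suc i * (d - Suc i)) = q powi (int d - 2 * int i - 1) * q ^ (i * (d - i))"
    using q by (metis power_int_add power_int_of_nat)
  moreover have "a powi (- int (Suc i)) = inverse a * a powi (- int i)"
    using a by (simp add: power_int_minus del: of_nat_Suc)
  ultimately show ?thesis
    unfolding huang_weight_def by simp
qed

text \<open>
  With \<open>\<rho> = 1 / (q\<^sup>2 - q\<^sup>-\<^sup>2)\<close>, consecutive eigenvalues satisfy
  \<open>\<rho> (q \<theta>\<^sub>i\<^sub>+\<^sub>1 - q\<^sup>-\<^sup>1 \<theta>\<^sub>i) = a q\<^sup>2\<^sup>i\<^sup>+\<^sup>1\<^sup>-\<^sup>d\<close> and \<open>\<rho> (q \<theta>\<^sub>i - q\<^sup>-\<^sup>1 \<theta>\<^sub>i\<^sub>+\<^sub>1) = a\<^sup>-\<^sup>1 q\<^sup>d\<^sup>-\<^sup>2\<^sup>i\<^sup>-\<^sup>1\<close>: in each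
  difference one of the two exponentials cancels. Up to sign these are the two quotients of
  consecutive weights.
\<close>

lemma huang_theta_weight_Suc:
  fixes q a :: "'a::field"
  assumes q: "q \<noteq> 0" "q ^ 4 \<noteq> 1" and a: "a \<noteq> 0" and i: "i < d"
  defines "\<rho> \<equiv> inverse (q ^ 2 - q powi (-2))"
    and "\<theta> \<equiv> huang_theta q d a" and "t \<equiv> huang_weight q d a"
  shows "\<rho> * (q * \<theta> (Suc i) - inverse q * \<theta> i) * t (Suc i) = - t i"
    and "\<rho> * (q * \<theta> i - inverse q * \<theta> (Suc i)) * t i = - t (Suc i)"
proof -
  \<comment> \<open>The exponent lies midway between those in \<open>\<theta> i\<close> and \<open>\<theta> (Suc i)\<close>.\<close>
  define p where "p = q powi (int d - 2 * int i - 1)"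
  have p: "p \<noteq> 0" using q by (simp add: p_def)
  have nz: "q ^ 2 - q powi (-2) \<noteq> 0"
    using q by (simp add: power_int_minus field_simps power2_eq_square power4_eq_xxxx)
  have e: "q powi (2 * int i - int d) = inverse (q * p)"
    "q powi (int d - 2 * int i) = q * p"
    "q powi (2 * int (Suc i) - int d) = q * inverse p"
    "q powi (int d - 2 * int (Suc i)) = inverse q * p"
    using q unfolding p_def
    by (simp_all add: power_int_diff power_int_add power_int_minus field_simps power2_eq_square)
  have th: "\<theta> i = a * inverse (q * p) + inverse a * (q * p)"
    "\<theta> (Suc i) = a * (q * inverse p) + inverse a * (inverse q * p)"
    unfolding \<theta>_def huang_theta_def e by simp_all
  have w: "t (Suc i) = - inverse a * p * t i"
    unfolding t_def p_def by (rule huang_weight_Suc) (use q a i in auto)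
  have "q * \<theta> (Suc i) - inverse q * \<theta> i = (q ^ 2 - q powi (-2)) * (a * inverse p)"
    using q p a by (simp add: th power_int_minus field_simps power2_eq_square)
  hence "\<rho> * (q * \<theta> (Suc i) - inverse q * \<theta> i) = a * inverse p"
    using nz by (simp add: \<rho>_def flip: mult.assoc)
  thus "\<rho> * (q * \<theta> (Suc i) - inverse q * \<theta> i) * t (Suc i) = - t i"
    using a p by (simp add: w) (simp add: field_simps)
  have "q * \<theta> i - inverse q * \<theta> (Suc i) = (q ^ 2 - q powi (-2)) * (inverse a * p)"
    using q p a by (simp add: th power_int_minus field_simps power2_eq_square)
  hence "\<rho> * (q * \<theta> i - inverse q * \<theta> (Suc i)) = inverse a * p"
    using nz by (simp add: \<rho>_def flip: mult.assoc)
  thus "\<rho> * (q * \<theta> i - inverse q * \<theta> (Suc i)) * t i = - t (Suc i)"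
    by (simp add: w)
qed

text \<open>
  This is the equality of the \<open>(i, j)\<close> entries in the intertwining identity, with the common factor
  \<open>Y\<^sub>i\<^sub>j\<close> removed.
\<close>

lemma huang_theta_weight:
  fixes q a :: "'a::field"
  assumes q: "q \<noteq> 0" "q ^ 4 \<noteq> 1" and a: "a \<noteq> 0" and ij: "i \<le> d" "j \<le> d"
    and near: "i = j \<or> i = Suc j \<or> j = Suc i"
  defines "\<rho> \<equiv> inverse (q ^ 2 - q powi (-2))"
    and "\<theta> \<equiv> huang_theta q d a" and "t \<equiv> huang_weight q d a"
  shows "(1 - \<rho> * (q * \<theta> i - inverse q * \<theta> j)) * t i =
    (1 - \<rho> * (q * \<theta> j - inverse q * \<theta> i)) * t j"
  using near
proof (elim disjE)
  assume "i = j"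
  thus ?thesis by simp
next
  assume "i = Suc j"
  thus ?thesis
    using huang_theta_weight_Suc[OF q a, of j d] ij
    by (simp add: left_diff_distrib \<rho>_def \<theta>_def t_def)
next
  assume "j = Suc i"
  thus ?thesis
    using huang_theta_weight_Suc[OF q a, of i d] ij
    by (simp add: left_diff_distrib \<rho>_def \<theta>_def t_def)
qed

section \<open>The operators in an eigenbasis\<close>

context vector_space_of_dim
begin

interpretation endo: vector_space_pair scale scale
  by unfold_locales

lemma linear_comp:
  assumes "Vector_Spaces.linear (*s) (*s) f" "Vector_Spaces.linear (*s) (*s) g"
  shows "Vector_Spaces.linear (*s) (*s) (\<lambda>x. f (g x))"
  using Vector_Spaces.linear_compose[OF assms(2,1)] by (simp add: o_def)

lemma linear_eq_on_ordered_basis: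
  assumes "ordered_basis v" "Vector_Spaces.linear (*s) (*s) f" "Vector_Spaces.linear (*s) (*s) g"
    and "\<And>j. j \<le> d \<Longrightarrow> f (v j) = g (v j)"
  shows "f = g"
proof
  fix x
  have "x \<in> span (v ` {..d})"
    using assms(1) by (simp add: ordered_basis_def)
  thus "f x = g x"
    by (rule endo.linear_eq_on_span[OF assms(2,3), rotated]) (use assms(4) in auto)
qed

text \<open>
  The definite description that defines \<open>primitive_idempotent\<close> is met by the coordinate projection
  for an eigenbasis with distinct eigenvalues. That this projection \<open>E i\<close> fixes the \<open>\<theta> i\<close>-eigenspace
  follows from \<open>(\<Sum>j\<le>d. E j) = id\<close>: on that space \<open>E j\<close> vanishes for \<open>j \<noteq> i\<close>, because
  \<open>E j \<circ> A = A \<circ> E j = \<theta> j E j\<close> and the eigenvalues differ.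
\<close>

lemma primitive_idempotent_eigenbasis:
  assumes A: "Vector_Spaces.linear (*s) (*s) A" and v: "ordered_basis v"
    and \<theta>: "bij_betw \<theta> {..d} (eigenvalues A)"
    and ev: "\<And>i. i \<le> d \<Longrightarrow> A (v i) = \<theta> i *s v i"
    and i: "i \<le> d"
  shows "Vector_Spaces.linear (*s) (*s) (primitive_idempotent A (\<theta> i))"
    and "j \<le> d \<Longrightarrow> primitive_idempotent A (\<theta> i) (v j) = (if j = i then v j else 0)"
proof -
  have inj: "inj_on v {..d}" and ind: "independent (v ` {..d})"
    using v by (auto simp: ordered_basis_def)
  have \<theta>inj: "\<theta> j = \<theta> k \<longleftrightarrow> j = k" if "j \<le> d" "k \<le> d" for j k
    using \<theta> that by (auto simp: bij_betw_def inj_on_def)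
  have "\<exists>E. Vector_Spaces.linear (*s) (*s) E \<and>
      (\<forall>j\<le>d. E (v j) = (if j = k then v j else 0))" if k: "k \<le> d" for k
  proof -
    obtain E where "Vector_Spaces.linear (*s) (*s) E"
      "\<forall>x\<in>v ` {..d}. E x = (if x = v k then x else 0)"
      using endo.linear_independent_extend[OF ind, of "\<lambda>x. if x = v k then x else 0"] by blast
    thus ?thesis
      using inj k by (intro exI[of _ E]) (auto simp: inj_on_def)
  qed
  then obtain E where E: "\<And>k. k \<le> d \<Longrightarrow> Vector_Spaces.linear (*s) (*s) (E k)"
    "\<And>k j. k \<le> d \<Longrightarrow> j \<le> d \<Longrightarrow> E k (v j) = (if j = k then v j else 0)"
    by metis
  have AE: "A (E k x) = \<theta> k *s E k x" and EA: "E k (A x) = A (E k x)" if k: "k \<le> d" for k x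
  proof -
    have "(\<lambda>x. A (E k x)) = (\<lambda>x. \<theta> k *s E k x)"
      by (rule linear_eq_on_ordered_basis[OF v])
        (use k E A ev in \<open>auto intro!: endo.linear_compose_scale_right
          simp: linear_comp[OF A E(1)] endo.linear_0\<close>)
    thus "A (E k x) = \<theta> k *s E k x" by metis
    have "(\<lambda>x. E k (A x)) = (\<lambda>x. A (E k x))"
      by (rule linear_eq_on_ordered_basis[OF v])
        (use k E A ev in \<open>auto simp: linear_comp[OF A E(1)] linear_comp[OF E(1) A] endo.linear_0
          endo.linear_scale\<close>)
    thus "E k (A x) = A (E k x)" by metis
  qed
  have kill: "E k x = 0" if "k \<le> d" "A x = s *s x" "s \<noteq> \<theta> k" for k x s
  proof -
    have "s *s E k x = \<theta> k *s E k x"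
      using AE[of k x] EA[of k x] that E(1)[of k] by (simp add: endo.linear_scale)
    thus ?thesis using that(3) by (simp add: scale_right_imp_eq)
  qed
  have total: "(\<Sum>k\<le>d. E k x) = x" for x
  proof -
    have "(\<lambda>x. \<Sum>k\<le>d. E k x) = (\<lambda>x. x)"
    proof (rule linear_eq_on_ordered_basis[OF v])
      show "Vector_Spaces.linear (*s) (*s) (\<lambda>x. \<Sum>k\<le>d. E k x)"
        using E(1) by (intro endo.linear_compose_sum) auto
      show "Vector_Spaces.linear (*s) (*s) (\<lambda>x. x)" by (rule linear_ident)
      show "(\<Sum>k\<le>d. E k (v j)) = v j" if "j \<le> d" for j
        using that E(2) by (simp add: sum.delta')
    qed
    thus ?thesis by metis
  qed
  have fix_eigenspace: "E i x = x" if "A x = \<theta> i *s x" for x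
  proof -
    have "E k x = 0" if "k \<le> d" "k \<noteq> i" for k
      using kill[OF that(1) \<open>A x = \<theta> i *s x\<close>] \<theta>inj i that by auto
    hence "(\<Sum>k\<le>d. E k x) = (\<Sum>k\<in>{i}. E k x)"
      by (intro sum.mono_neutral_right) (use i in auto)
    thus ?thesis using total[of x] by simp
  qed
  have "primitive_idempotent A (\<theta> i) = E i"
    unfolding primitive_idempotent_def
  proof (rule the_equality, intro conjI ballI)
    show "Vector_Spaces.linear (*s) (*s) (E i)" by (rule E(1)[OF i])
    show "range (E i) = eigenspace A (\<theta> i)"
    proof (intro equalityI subsetI)
      show "x \<in> eigenspace A (\<theta> i)" if "x \<in> range (E i)" for x
        using that AE[OF i] by (auto simp: eigenspace_def)
      show "x \<in> range (E i)" if "x \<in> eigenspace A (\<theta> i)" for x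
        using that fix_eigenspace[of x] by (auto simp: eigenspace_def intro: range_eqI[of _ _ x])
    qed
    show "E i x = x" if "x \<in> eigenspace A (\<theta> i)" for x
      using that fix_eigenspace by (simp add: eigenspace_def)
    show "E i x = 0" if "s \<in> eigenvalues A - {\<theta> i}" "x \<in> eigenspace A s" for s x
      using that kill[OF i, of x s] by (auto simp: eigenspace_def)
  next
    fix F
    assume F: "Vector_Spaces.linear (*s) (*s) F \<and> range F = eigenspace A (\<theta> i) \<and>
      (\<forall>v\<in>eigenspace A (\<theta> i). F v = v) \<and>
      (\<forall>s\<in>eigenvalues A - {\<theta> i}. \<forall>v\<in>eigenspace A s. F v = 0)"
    have ev': "v j \<in> eigenspace A (\<theta> j)" if "j \<le> d" for j
      using ev that by (simp add: eigenspace_def)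
    have "\<theta> j \<in> eigenvalues A - {\<theta> i}" if "j \<le> d" "j \<noteq> i" for j
      using \<theta> \<theta>inj i that by (auto simp: bij_betw_def)
    hence "F (v j) = (if j = i then v j else 0)" if "j \<le> d" for j
      using F ev'[OF that] that by (cases "j = i") (simp, metis)
    thus "F = E i"
      by (intro linear_eq_on_ordered_basis[OF v]) (use F E i in auto)
  qed
  thus "Vector_Spaces.linear (*s) (*s) (primitive_idempotent A (\<theta> i))"
    and "j \<le> d \<Longrightarrow> primitive_idempotent A (\<theta> i) (v j) = (if j = i then v j else 0)"
    using E i by simp_all
qed

lemma huang_W_eigenbasis:
  assumes A: "Vector_Spaces.linear (*s) (*s) A" and v: "ordered_basis v"
    and \<theta>: "bij_betw (huang_theta q d a) {..d} (eigenvalues A)"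
    and ev: "\<And>i. i \<le> d \<Longrightarrow> A (v i) = huang_theta q d a i *s v i"
  shows "Vector_Spaces.linear (*s) (*s) (huang_W q a A)"
    and "j \<le> d \<Longrightarrow> huang_W q a A (v j) = huang_weight q d a j *s v j"
proof -
  note E = primitive_idempotent_eigenbasis[OF A v \<theta> ev]
  have W: "huang_W q a A =
      (\<lambda>x. \<Sum>i\<le>d. huang_weight q d a i *s primitive_idempotent A (huang_theta q d a i) x)"
    by (simp add: fun_eq_iff huang_W_def huang_weight_def)
  show "Vector_Spaces.linear (*s) (*s) (huang_W q a A)"
    unfolding W using E(1)
    by (intro endo.linear_compose_sum ballI endo.linear_compose_scale_right) auto
  show "huang_W q a A (v j) = huang_weight q d a j *s v j" if "j \<le> d"
  proof -
    have "huang_W q a A (v j) = (\<Sum>i\<le>d. if j = i then huang_weight q d a i *s v j else 0)"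
      unfolding W by (rule sum.cong) (use E(2) that in auto)
    thus ?thesis using that by simp
  qed
qed

section \<open>Intertwining and commutation\<close>

text \<open>
  The third member of a triple, solved for from its relation. As an expression in \<open>X\<close> and \<open>Y\<close> it
  can be evaluated with the two maps exchanged, which yields the mirror image \<open>Z\<^sub>o\<close>.
\<close>

definition q_racah_third :: "'a \<Rightarrow> 'a \<Rightarrow> ('b \<Rightarrow> 'b) \<Rightarrow> ('b \<Rightarrow> 'b) \<Rightarrow> 'b \<Rightarrow> 'b" where
  "q_racah_third q \<alpha> X Y x =
     \<alpha> *s x - inverse (q ^ 2 - q powi (-2)) *s (q *s X (Y x) - inverse q *s Y (X x))"

text \<open>
  A Leonard triple is a condition on three maps at once, whereas the intertwining identity is applied
  to ordered pairs of them, in both orders; this predicate is the part of the condition that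
  speaks of one such pair.
\<close>

definition tridiagonal_eigenbasis ::
    "('b \<Rightarrow> 'b) \<Rightarrow> ('b \<Rightarrow> 'b) \<Rightarrow> (nat \<Rightarrow> 'a) \<Rightarrow> (nat \<Rightarrow> 'b) \<Rightarrow> bool" where
  "tridiagonal_eigenbasis X Y \<theta> v \<longleftrightarrow>
     ordered_basis v \<and> bij_betw \<theta> {..d} (eigenvalues X) \<and>
     (\<forall>i\<le>d. X (v i) = \<theta> i *s v i) \<and>
     (\<exists>M. represented_by v Y M \<and> tridiagonal_matrix d M)"

lemma standard_ordering_tridiagonal_eigenbasis:
  assumes "standard_ordering X Y Z \<theta>"
  shows "\<exists>v. tridiagonal_eigenbasis X Y \<theta> v" and "\<exists>v. tridiagonal_eigenbasis X Z \<theta> v"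
  using assms
  unfolding standard_ordering_def tridiagonal_eigenbasis_def leonard_basis_def
    irreducible_tridiagonal_matrix_def eigenspace_def by blast+

lemma linear_q_racah_sum:
  assumes "Vector_Spaces.linear (*s) (*s) X" "Vector_Spaces.linear (*s) (*s) Y"
  shows "Vector_Spaces.linear (*s) (*s) (\<lambda>x. X x + Y x + q_racah_third q \<alpha> X Y x)"
    and "Vector_Spaces.linear (*s) (*s) (\<lambda>x. X x + Y x + q_racah_third q \<alpha> Y X x)"
  unfolding q_racah_third_def
  by (intro endo.linear_compose_add endo.linear_compose_sub endo.linear_compose_scale_right
      assms linear_ident linear_comp[OF assms] linear_comp[OF assms(2,1)])+

text \<open>
  Both sides are linear, so it suffices to compare them on the eigenbasis. The terms with
  \<open>X\<close> and \<open>\<alpha>\<close> are diagonal and agree; the rest is the scalar identity, entry by entry.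
\<close>

lemma huang_W_intertwines:
  assumes q: "q \<noteq> 0" "q ^ 4 \<noteq> 1" and a: "a \<noteq> 0"
    and X: "Vector_Spaces.linear (*s) (*s) X" and Y: "Vector_Spaces.linear (*s) (*s) Y"
    and v: "tridiagonal_eigenbasis X Y (huang_theta q d a) v"
  shows "huang_W q a X (X x + Y x + q_racah_third q \<alpha> X Y x) =
    (let y = huang_W q a X x in X y + Y y + q_racah_third q \<alpha> Y X y)"
proof -
  define W where "W = huang_W q a X"
  define \<theta> where "\<theta> = huang_theta q d a"
  define t where "t = huang_weight q d a"
  define \<rho> where "\<rho> = inverse (q ^ 2 - q powi (-2))"
  define U where "U x = X x + Y x + q_racah_third q \<alpha> X Y x" for x
  define U' where "U' x = X x + Y x + q_racah_third q \<alpha> Y X x" for x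
  obtain M where M: "represented_by v Y M" "tridiagonal_matrix d M"
    using v unfolding tridiagonal_eigenbasis_def by blast
  have basis: "ordered_basis v" and bij: "bij_betw (huang_theta q d a) {..d} (eigenvalues X)"
    and Xv: "\<And>i. i \<le> d \<Longrightarrow> X (v i) = \<theta> i *s v i"
    using v unfolding tridiagonal_eigenbasis_def \<theta>_def by auto
  have Yv: "Y (v j) = (\<Sum>i\<le>d. M i j *s v i)" if "j \<le> d" for j
    using M(1) that by (simp add: represented_by_def)
  have W: "Vector_Spaces.linear (*s) (*s) W" "\<And>j. j \<le> d \<Longrightarrow> W (v j) = t j *s v j"
    using huang_W_eigenbasis[OF X basis bij] Xv unfolding W_def t_def \<theta>_def by auto
  have linU: "Vector_Spaces.linear (*s) (*s) U" "Vector_Spaces.linear (*s) (*s) U'"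
    unfolding U_def U'_def by (rule linear_q_racah_sum[OF X Y])+
  have XYv: "X (Y (v j)) = (\<Sum>i\<le>d. (\<theta> i * M i j) *s v i)"
    and YXv: "Y (X (v j)) = (\<Sum>i\<le>d. (\<theta> j * M i j) *s v i)" if "j \<le> d" for j
    using that Xv
    by (auto simp: Yv endo.linear_sum[OF X] endo.linear_scale[OF X] endo.linear_scale[OF Y]
        scale_sum_right mult.commute intro!: sum.cong)
  have Uv: "U (v j) = (\<theta> j + \<alpha>) *s v j +
      (\<Sum>i\<le>d. ((1 - \<rho> * (q * \<theta> i - inverse q * \<theta> j)) * M i j) *s v i)"
    and U'v: "U' (v j) = (\<theta> j + \<alpha>) *s v j +
      (\<Sum>i\<le>d. ((1 - \<rho> * (q * \<theta> j - inverse q * \<theta> i)) * M i j) *s v i)" if "j \<le> d" for j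
    unfolding U_def U'_def q_racah_third_def \<rho>_def[symmetric] XYv[OF that] YXv[OF that]
    unfolding Xv[OF that] Yv[OF that]
    by (simp_all add: scale_sum_right algebra_simps sum.distrib sum_subtractf)
  have "(\<lambda>x. W (U x)) = (\<lambda>x. U' (W x))"
  proof (rule linear_eq_on_ordered_basis[OF basis])
    show "Vector_Spaces.linear (*s) (*s) (\<lambda>x. W (U x))"
      "Vector_Spaces.linear (*s) (*s) (\<lambda>x. U' (W x))"
      using W(1) linU by (simp_all add: linear_comp)
    fix j assume j: "j \<le> d"
    have entry: "(1 - \<rho> * (q * \<theta> i - inverse q * \<theta> j)) * M i j * t i =
        t j * ((1 - \<rho> * (q * \<theta> j - inverse q * \<theta> i)) * M i j)" if i: "i \<le> d" for i
    proof (cases "M i j = 0")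
      case False
      hence "i = j \<or> i = Suc j \<or> j = Suc i"
        using M(2) i j by (simp add: tridiagonal_matrix_def)
      from arg_cong[OF huang_theta_weight[OF q a i j this], of "\<lambda>z. M i j * z"] show ?thesis
        unfolding \<rho>_def \<theta>_def t_def by (simp only: mult_ac)
    qed simp
    have "W (U (v j)) = ((\<theta> j + \<alpha>) * t j) *s v j +
        (\<Sum>i\<le>d. ((1 - \<rho> * (q * \<theta> i - inverse q * \<theta> j)) * M i j * t i) *s v i)"
      using j W by (simp add: Uv endo.linear_add endo.linear_scale endo.linear_sum)
    also have "\<dots> = t j *s U' (v j)"
      unfolding U'v[OF j] scale_right_distrib scale_sum_right scale_scale mult.commute[of _ "t j"]
      by (intro arg_cong2[where f = "(+)"] sum.cong refl)
        (simp only: entry atMost_iff)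
    also have "\<dots> = U' (W (v j))"
      using j W(2) linU(2) by (simp add: endo.linear_scale)
    finally show "W (U (v j)) = U' (W (v j))" .
  qed
  thus ?thesis
    unfolding W_def U_def U'_def Let_def by metis
qed

text \<open>
  The first factor turns \<open>Z\<close> into its mirror image, and the second, applied with \<open>X\<close> and \<open>Y\<close>
  exchanged, turns it back.
\<close>

lemma huang_W_comp_commute:
  assumes q: "q \<noteq> 0" "q ^ 4 \<noteq> 1" and ab: "a \<noteq> 0" "b \<noteq> 0"
    and X: "Vector_Spaces.linear (*s) (*s) X" and Y: "Vector_Spaces.linear (*s) (*s) Y"
    and v: "tridiagonal_eigenbasis X Y (huang_theta q d a) v"
    and w: "tridiagonal_eigenbasis Y X (huang_theta q d b) w"
    and Z: "q_racah_relation q \<alpha> Z X Y"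
  shows "huang_W q b Y (huang_W q a X (X x + Y x + Z x)) =
    (let y = huang_W q b Y (huang_W q a X x) in X y + Y y + Z y)"
proof -
  have Z: "Z x = q_racah_third q \<alpha> X Y x" for x
    using Z unfolding q_racah_relation_def q_racah_third_def by (metis add_diff_cancel_right')
  show ?thesis
    using huang_W_intertwines[OF q ab(1) X Y v, of x \<alpha>]
      huang_W_intertwines[OF q ab(2) Y X w, of "huang_W q a X x" \<alpha>]
    by (simp add: Z Let_def add.commute add.left_commute)
qed

end

theorem lemma13p1:
  fixes scale :: "'f::field \<Rightarrow> 'v::ab_group_add \<Rightarrow> 'v"
    and d :: nat and q a b c :: 'f
    and A B C W W' W'' S :: "'v \<Rightarrow> 'v"
  assumes "vector_space_of_dim scale d"
    and "huang_parameters q a b c d"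
    and "vector_space_of_dim.q_racah_leonard_triple scale d q a b c A B C"
  defines "W \<equiv> vector_space_of_dim.huang_W scale d q a A"
    and "W' \<equiv> vector_space_of_dim.huang_W scale d q b B"
    and "W'' \<equiv> vector_space_of_dim.huang_W scale d q c C"
    and "S \<equiv> (\<lambda>v. A v + B v + C v)"
  shows "(W' \<circ> W) \<circ> S = S \<circ> (W' \<circ> W)
       \<and> (W'' \<circ> W') \<circ> S = S \<circ> (W'' \<circ> W')
       \<and> (W \<circ> W'') \<circ> S = S \<circ> (W \<circ> W'')"
proof -
  interpret V: vector_space_of_dim scale d by fact
  have q: "q \<noteq> 0" "q ^ 4 \<noteq> 1" and abc: "a \<noteq> 0" "b \<noteq> 0" "c \<noteq> 0"
    using assms(2) by (simp_all add: huang_parameters_def)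
  have lin: "Vector_Spaces.linear scale scale A" "Vector_Spaces.linear scale scale B"
      "Vector_Spaces.linear scale scale C"
    and std: "V.standard_ordering A B C (huang_theta q d a)"
      "V.standard_ordering B C A (huang_theta q d b)"
      "V.standard_ordering C A B (huang_theta q d c)"
    and rel: "V.q_racah_relation q (huang_alpha q d a b c) A B C"
      "V.q_racah_relation q (huang_alpha q d b c a) B C A"
      "V.q_racah_relation q (huang_alpha q d c a b) C A B"
    using assms(3) by (simp_all add: V.q_racah_leonard_triple_def V.leonard_triple_def)
  note basis = V.standard_ordering_tridiagonal_eigenbasis
  obtain vAB vAC vBC vBA vCA vCB where v:
    "V.tridiagonal_eigenbasis A B (huang_theta q d a) vAB"
    "V.tridiagonal_eigenbasis A C (huang_theta q d a) vAC"
    "V.tridiagonal_eigenbasis B C (huang_theta q d b) vBC"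
    "V.tridiagonal_eigenbasis B A (huang_theta q d b) vBA"
    "V.tridiagonal_eigenbasis C A (huang_theta q d c) vCA"
    "V.tridiagonal_eigenbasis C B (huang_theta q d c) vCB"
    using basis[OF std(1)] basis[OF std(2)] basis[OF std(3)] by blast
  note commute = V.huang_W_comp_commute[OF q]
  have "(W' \<circ> W) \<circ> S = S \<circ> (W' \<circ> W)"
    using commute[OF abc(1,2) lin(1,2) v(1,4) rel(3)]
    by (simp add: fun_eq_iff W_def W'_def S_def Let_def)
  moreover have "(W'' \<circ> W') \<circ> S = S \<circ> (W'' \<circ> W')"
    using commute[OF abc(2,3) lin(2,3) v(3,6) rel(1)]
    by (simp add: fun_eq_iff W'_def W''_def S_def Let_def add.commute add.left_commute)
  moreover have "(W \<circ> W'') \<circ> S = S \<circ> (W \<circ> W'')"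
    using commute[OF abc(3,1) lin(3,1) v(5,2) rel(2)]
    by (simp add: fun_eq_iff W_def W''_def S_def Let_def add.commute add.left_commute)
  ultimately show ?thesis by blast
qed

end
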